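(* Let $\Gamma$ be a minimal prime graph and let $K\subseteq V(\Gamma)$ be such that (i) $K$ is a maximal clique in $\Gamma$, and (ii) there exists a proper 3-coloring of $\overline{\Gamma}$ in which the vertices of $K$ are colored using at most two colors. Then $V(\Gamma)\setminus K$ is a generation site; that is, the graph obtained from $\Gamma$ by adding a new vertex $w$ adjacent exactly to the vertices of $V(\Gamma)\setminus K$ is a minimal prime graph.
   Context: All graphs are finite, simple and undirected; $\overline{\Gamma}$ is the complement of $\Gamma$. A clique is a set of pairwise adjacent vertices; it is maximal if it is not properly contained in another clique. A minimal prime graph is a connected graph $\Gamma$ on two or more vertices such that (1) $\overline{\Gamma}$ is triangle-free, (2) $\overline{\Gamma}$ is 3-colorable, and (3) for every edge $e$ of $\Gamma$, the complement of the graph obtained from $\Gamma$ by deleting $e$ is not both triangle-free and 3-colorable. For a minimal prime graph $\Gamma$, a subset $U\subseteq V(\Gamma)$ is a generation site if the graph obtained from $\Gamma$ by adding a new vertex $w$ and edges $\{w,u\}$ for all $u\in U$ is a minimal prime graph. *)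

theory Defs
  imports "Graph_Theory.Digraph_Component"
begin

text \<open>
  A finite simple undirected graph is a \<^locale>\<open>pair_graph\<close>: a finite, loop-free, symmetric
  digraph without parallel arcs. The undirected edge between \<open>u\<close> and \<open>v\<close> is represented by
  the two arcs \<open>(u, v)\<close> and \<open>(v, u)\<close>.
\<close>

definition graph_complement :: "'a pair_pre_digraph \<Rightarrow> 'a pair_pre_digraph" where
  "graph_complement G =
     \<lparr> pverts = pverts G,
       parcs = {(u, v). u \<in> pverts G \<and> v \<in> pverts G \<and> u \<noteq> v \<and> (u, v) \<notin> parcs G} \<rparr>"

definition delete_edge :: "'a pair_pre_digraph \<Rightarrow> 'a \<Rightarrow> 'a \<Rightarrow> 'a pair_pre_digraph" where
  "delete_edge G u v = \<lparr> pverts = pverts G, parcs = parcs G - {(u, v), (v, u)} \<rparr>"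

definition triangle_free :: "'a pair_pre_digraph \<Rightarrow> bool" where
  "triangle_free G \<longleftrightarrow>
     \<not> (\<exists>x y z. (x, y) \<in> parcs G \<and> (y, z) \<in> parcs G \<and> (x, z) \<in> parcs G)"

definition proper_coloring :: "nat \<Rightarrow> 'a pair_pre_digraph \<Rightarrow> ('a \<Rightarrow> nat) \<Rightarrow> bool" where
  "proper_coloring k G c \<longleftrightarrow>
     (\<forall>v\<in>pverts G. c v < k) \<and> (\<forall>(u, v)\<in>parcs G. c u \<noteq> c v)"

definition colorable :: "nat \<Rightarrow> 'a pair_pre_digraph \<Rightarrow> bool" where
  "colorable k G \<longleftrightarrow> (\<exists>c. proper_coloring k G c)"

definition clique :: "'a pair_pre_digraph \<Rightarrow> 'a set \<Rightarrow> bool" where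
  "clique G K \<longleftrightarrow> K \<subseteq> pverts G \<and> (\<forall>u\<in>K. \<forall>v\<in>K. u \<noteq> v \<longrightarrow> (u, v) \<in> parcs G)"

definition maximal_clique :: "'a pair_pre_digraph \<Rightarrow> 'a set \<Rightarrow> bool" where
  "maximal_clique G K \<longleftrightarrow> clique G K \<and> \<not> (\<exists>K'. clique G K' \<and> K \<subset> K')"

definition minimal_prime_graph :: "'a pair_pre_digraph \<Rightarrow> bool" where
  "minimal_prime_graph G \<longleftrightarrow>
     pair_graph G \<and>
     Digraph_Component.connected (with_proj G) \<and>
     2 \<le> card (pverts G) \<and>
     triangle_free (graph_complement G) \<and>
     colorable 3 (graph_complement G) \<and>
     (\<forall>(u, v)\<in>parcs G.
        \<not> (triangle_free (graph_complement (delete_edge G u v)) \<and>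
           colorable 3 (graph_complement (delete_edge G u v))))"

text \<open>
  The new vertex is \<^term>\<open>None\<close> and an old vertex \<open>v\<close> becomes \<^term>\<open>Some v\<close>. This way a new vertex
  exists even if the vertices of \<open>G\<close> exhaust their type.
\<close>

definition add_vertex :: "'a pair_pre_digraph \<Rightarrow> 'a set \<Rightarrow> 'a option pair_pre_digraph" where
  "add_vertex G U =
     \<lparr> pverts = insert None (Some ` pverts G),
       parcs = {(Some u, Some v) | u v. (u, v) \<in> parcs G}
             \<union> {(None, Some u) | u. u \<in> U}
             \<union> {(Some u, None) | u. u \<in> U} \<rparr>"

definition generation_site :: "'a pair_pre_digraph \<Rightarrow> 'a set \<Rightarrow> bool" where
  "generation_site G U \<longleftrightarrow> U \<subseteq> pverts G \<and> minimal_prime_graph (add_vertex G U)"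

end

theory Submission
  imports Defs
begin

text \<open>
  In the complement, the new vertex is adjacent exactly to \<open>K\<close>. Since \<open>K\<close> is independent there, no
  triangle arises, and a color missing on \<open>K\<close> is free for the new vertex. Deleting an old edge is
  still impossible because the old complement is an induced subgraph of the new one. Deleting an
  edge from the new vertex to \<open>u \<notin> K\<close> creates a triangle in the complement, whose third vertex is a
  non-neighbor of \<open>u\<close> in \<open>K\<close>, provided by maximality. Connectedness only requires \<open>K\<close> to be a proper
  subset of the vertices, and this holds because a complete graph on at least two vertices is not
  minimal.
\<close>

text \<open>Trades the locale for set-level conditions that can be checked on an explicitly built
  graph. Finiteness of the arc set follows from its inclusion in a finite square.\<close>

lemma pair_graph_iff:
  "pair_graph G \<longleftrightarrow> finite (pverts G) \<and> parcs G \<subseteq> pverts G \<times> pverts G \<and>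
     sym (parcs G) \<and> (\<forall>v. (v, v) \<notin> parcs G)"
proof
  assume "pair_graph G"
  then interpret pair_graph G .
  show "finite (pverts G) \<and> parcs G \<subseteq> pverts G \<times> pverts G \<and>
     sym (parcs G) \<and> (\<forall>v. (v, v) \<notin> parcs G)"
    using pair_finite_verts pair_sym_arcs pair_no_loops
    by (fastforce simp: symmetric_def dest: in_arcsD1 in_arcsD2)
next
  assume *: "finite (pverts G) \<and> parcs G \<subseteq> pverts G \<times> pverts G \<and>
     sym (parcs G) \<and> (\<forall>v. (v, v) \<notin> parcs G)"
  then have "finite (parcs G)"
    by (meson finite_SigmaI finite_subset)
  with * show "pair_graph G"
    by unfold_locales (auto simp: symmetric_def)
qed

text \<open>The arcs are already symmetric, so the symmetric closure in the definition of
  connectedness adds nothing.\<close>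

lemma connected_pair_graph_iff:
  assumes "pair_graph G"
  shows "Digraph_Component.connected (with_proj G) \<longleftrightarrow>
    pverts G \<noteq> {} \<and> (\<forall>u\<in>pverts G. \<forall>v\<in>pverts G. (u, v) \<in> (parcs G)\<^sup>*)"
proof -
  interpret pair_graph G by fact
  show ?thesis
    by (auto simp: Digraph_Component.connected_def strongly_connected_def
        reachable_mk_symmetric_eq[OF pair_sym_arcs] reachable_conv)
qed

lemma parcs_graph_complement_iff [simp]:
  "(u, v) \<in> parcs (graph_complement G) \<longleftrightarrow>
     u \<in> pverts G \<and> v \<in> pverts G \<and> u \<noteq> v \<and> (u, v) \<notin> parcs G"
  by (simp add: graph_complement_def)

lemma pverts_graph_complement [simp]: "pverts (graph_complement G) = pverts G"
  by (simp add: graph_complement_def)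

lemma pverts_delete_edge [simp]: "pverts (delete_edge G u v) = pverts G"
  by (simp add: delete_edge_def)

lemma parcs_delete_edge [simp]: "parcs (delete_edge G u v) = parcs G - {(u, v), (v, u)}"
  by (simp add: delete_edge_def)

lemma pverts_add_vertex [simp]: "pverts (add_vertex G U) = insert None (Some ` pverts G)"
  by (simp add: add_vertex_def)

lemma parcs_add_vertex_iff [simp]:
  "(Some x, Some y) \<in> parcs (add_vertex G U) \<longleftrightarrow> (x, y) \<in> parcs G"
  "(None, Some y) \<in> parcs (add_vertex G U) \<longleftrightarrow> y \<in> U"
  "(Some x, None) \<in> parcs (add_vertex G U) \<longleftrightarrow> x \<in> U"
  "(None, None) \<notin> parcs (add_vertex G U)"
  by (auto simp: add_vertex_def)

text \<open>A forbidden triple maps to a forbidden triple. With \<open>f = Some\<close>, this and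
  the next lemma pass properties of the new complement down to the old one.\<close>

lemma triangle_free_vimage:
  assumes "triangle_free H" "\<And>u v. (u, v) \<in> parcs G \<Longrightarrow> (f u, f v) \<in> parcs H"
  shows "triangle_free G"
  using assms unfolding triangle_free_def by blast

lemma colorable_vimage:
  assumes "colorable k H" "f ` pverts G \<subseteq> pverts H"
    "\<And>u v. (u, v) \<in> parcs G \<Longrightarrow> (f u, f v) \<in> parcs H"
  shows "colorable k G"
proof -
  obtain c where "proper_coloring k H c"
    using assms(1) by (auto simp: colorable_def)
  then have "proper_coloring k G (c \<circ> f)"
    using assms(2,3) by (fastforce simp: proper_coloring_def)
  then show ?thesis by (auto simp: colorable_def)
qed

lemma pair_graph_add_vertex:
  assumes "pair_graph G" "U \<subseteq> pverts G"
  shows "pair_graph (add_vertex G U)"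
  using assms unfolding pair_graph_iff
  by (auto simp: add_vertex_def sym_def)

lemma connected_add_vertex:
  assumes "pair_graph G" "Digraph_Component.connected (with_proj G)"
    and "U \<subseteq> pverts G" "U \<noteq> {}"
  shows "Digraph_Component.connected (with_proj (add_vertex G U))"
proof -
  let ?A = "parcs (add_vertex G U)"
  have old: "(Some x, Some y) \<in> ?A\<^sup>*" if "x \<in> pverts G" "y \<in> pverts G" for x y
  proof -
    have "(x, y) \<in> (parcs G)\<^sup>*"
      using assms(1,2) that by (simp add: connected_pair_graph_iff)
    then show ?thesis
      by induction (auto intro: rtrancl.rtrancl_into_rtrancl)
  qed
  obtain u where u: "u \<in> U" "u \<in> pverts G"
    using assms(3,4) by blast
  have "(None, Some u) \<in> ?A" "(Some u, None) \<in> ?A"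
    using u by simp_all
  \<comment> \<open>Every path to or from the new vertex is routed through its neighbor
    \<open>u\<close>.\<close>
  then have "(None, Some y) \<in> ?A\<^sup>*" "(Some y, None) \<in> ?A\<^sup>*" if "y \<in> pverts G" for y
    using old[of u y] old[of y u] u that
    by (meson converse_rtrancl_into_rtrancl rtrancl.rtrancl_into_rtrancl)+
  with old show ?thesis
    using pair_graph_add_vertex[OF assms(1,3)] by (auto simp: connected_pair_graph_iff)
qed

lemma triangle_free_complement_add_vertex:
  assumes "triangle_free (graph_complement G)" "clique G K"
  shows "triangle_free (graph_complement (add_vertex G (pverts G - K)))"
proof -
  let ?A = "parcs (graph_complement (add_vertex G (pverts G - K)))"
  have old: False
    if "(x, y) \<in> parcs (graph_complement G)" "(y, z) \<in> parcs (graph_complement G)"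
      "(x, z) \<in> parcs (graph_complement G)" for x y z
    using that assms(1) unfolding triangle_free_def by blast
  have new: "(x, y) \<in> parcs G" if "x \<in> K" "y \<in> K" "x \<noteq> y" for x y
    using that assms(2) by (simp add: clique_def)
  \<comment> \<open>A triple of old vertices contradicts \<open>old\<close>. In a triple containing
    \<open>None\<close>, the other two vertices lie in \<open>K\<close>, so \<open>new\<close> makes
    them adjacent in \<open>G\<close>.\<close>
  have False if "(x, y) \<in> ?A" "(y, z) \<in> ?A" "(x, z) \<in> ?A" for x y z
    using that old new by (cases x; cases y; cases z) (auto simp: image_iff)
  then show ?thesis unfolding triangle_free_def by blast
qed

lemma colorable_complement_add_vertex:
  assumes "proper_coloring k (graph_complement G) c" "card (c ` K) < k" "K \<subseteq> pverts G"
    and "pair_graph G"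
  shows "colorable k (graph_complement (add_vertex G (pverts G - K)))"
proof -
  have "finite K"
    using assms(3,4) finite_subset by (auto simp: pair_graph_iff)
  \<comment> \<open>Pigeonhole; finiteness of \<open>K\<close> matters because \<open>card\<close>
    is 0 on infinite sets.\<close>
  then have "\<not> {..<k} \<subseteq> c ` K"
    using assms(2) card_mono[of "c ` K" "{..<k}"] by auto
  then obtain j where "j < k" "j \<notin> c ` K" by auto
  with assms(1) have "proper_coloring k (graph_complement (add_vertex G (pverts G - K)))
      (case_option j c)"
    by (fastforce simp: proper_coloring_def split: option.split)
  then show ?thesis by (auto simp: colorable_def)
qed

text \<open>Deleting an edge of a complete graph leaves a complement with just that one edge, which
  is triangle-free and even 2-colorable. This contradicts minimality.\<close>

lemma minimal_prime_graph_not_clique: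
  assumes "minimal_prime_graph G"
  shows "\<not> clique G (pverts G)"
proof
  assume clique: "clique G (pverts G)"
  have "2 \<le> card (pverts G)"
    using assms by (simp add: minimal_prime_graph_def)
  then obtain u v where uv: "u \<in> pverts G" "v \<in> pverts G" "u \<noteq> v"
    by (auto simp: numeral_2_eq_2 card_le_Suc_iff)
  let ?H = "graph_complement (delete_edge G u v)"
  have arcs: "x = u \<and> y = v \<or> x = v \<and> y = u" if "(x, y) \<in> parcs ?H" for x y
    using that clique by (auto simp: clique_def)
  have "triangle_free ?H"
    unfolding triangle_free_def using arcs uv by metis
  moreover have "proper_coloring 3 ?H (\<lambda>x. if x = u then 0 else 1)"
    using arcs uv(3) by (fastforce simp: proper_coloring_def)
  moreover have "(u, v) \<in> parcs G"
    using clique uv by (simp add: clique_def)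
  ultimately show False
    using assms by (auto simp: minimal_prime_graph_def colorable_def)
qed

text \<open>Otherwise \<open>insert u K\<close> would be a larger clique; symmetry of the arcs gives
  both orientations.\<close>

lemma maximal_clique_nonneighbor:
  assumes "pair_graph G" "maximal_clique G K" "u \<in> pverts G" "u \<notin> K"
  obtains k where "k \<in> K" "(u, k) \<notin> parcs G" "(k, u) \<notin> parcs G"
proof -
  have "\<not> clique G (insert u K)"
    using assms(2,4) unfolding maximal_clique_def by blast
  moreover have "clique G K" "sym (parcs G)"
    using assms(1,2) by (auto simp: maximal_clique_def pair_graph_iff)
  ultimately show ?thesis
    using assms(3) that unfolding clique_def sym_def by blast
qed

lemma not_triangle_free_delete_new_edge:
  assumes "pair_graph G" "maximal_clique G K" "u \<in> pverts G - K"
    and "(a, b) = (None, Some u) \<or> (a, b) = (Some u, None)"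
  shows "\<not> triangle_free (graph_complement (delete_edge (add_vertex G (pverts G - K)) a b))"
proof -
  let ?A = "parcs (graph_complement (delete_edge (add_vertex G (pverts G - K)) a b))"
  obtain k where "k \<in> K" "(u, k) \<notin> parcs G"
    using maximal_clique_nonneighbor[OF assms(1,2)] assms(3) by blast
  moreover from this have "k \<in> pverts G" "u \<noteq> k"
    using assms(2,3) by (auto simp: maximal_clique_def clique_def)
  \<comment> \<open>The three arcs arise, in order, from the deleted edge, from the non-edge of
    \<open>G\<close> given by maximality, and from \<open>k\<close> lying outside the neighborhood
    of \<open>None\<close>.\<close>
  ultimately have "(None, Some u) \<in> ?A" "(Some u, Some k) \<in> ?A" "(None, Some k) \<in> ?A"
    using assms(3,4) by auto
  then show ?thesis
    unfolding triangle_free_def by blast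
qed

theorem mainTheorem19:
  fixes G :: "'a pair_pre_digraph" and K :: "'a set"
  assumes "minimal_prime_graph G"
    and "maximal_clique G K"
    and "\<exists>c. proper_coloring 3 (graph_complement G) c \<and> card (c ` K) \<le> 2"
  shows "generation_site G (pverts G - K)"
proof -
  let ?U = "pverts G - K"
  let ?H = "add_vertex G ?U"
  have G: "pair_graph G" "Digraph_Component.connected (with_proj G)" "2 \<le> card (pverts G)"
      "triangle_free (graph_complement G)"
    and min: "\<And>u v. (u, v) \<in> parcs G \<Longrightarrow>
      \<not> (triangle_free (graph_complement (delete_edge G u v)) \<and>
         colorable 3 (graph_complement (delete_edge G u v)))"
    using assms(1) by (auto simp: minimal_prime_graph_def)
  have K: "clique G K" "K \<subseteq> pverts G"
    using assms(2) by (auto simp: maximal_clique_def clique_def)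
  have "?U \<noteq> {}"
    \<comment> \<open>If nothing were left outside \<open>K\<close>, the whole vertex set would be a
      clique.\<close>
    using minimal_prime_graph_not_clique[OF assms(1)] K by auto
  then have "Digraph_Component.connected (with_proj ?H)"
    using G(1,2) by (intro connected_add_vertex) auto
  moreover have "2 \<le> card (pverts ?H)"
    using G(1,3) by (simp add: card_image pair_graph_iff)
  moreover have "colorable 3 (graph_complement ?H)"
    using assms(3) colorable_complement_add_vertex[OF _ _ K(2) G(1)] by fastforce
  moreover have "\<not> (triangle_free (graph_complement (delete_edge ?H a b)) \<and>
      colorable 3 (graph_complement (delete_edge ?H a b)))" if ab: "(a, b) \<in> parcs ?H" for a b
  proof (cases "a = None \<or> b = None")
    case True
    then obtain u where "u \<in> ?U" "(a, b) = (None, Some u) \<or> (a, b) = (Some u, None)"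
      using ab by (cases a; cases b) auto
    then show ?thesis
      using not_triangle_free_delete_new_edge[OF G(1) assms(2)] by blast
  next
    case False
    then obtain u v where [simp]: "a = Some u" "b = Some v" by auto
    have "(u, v) \<in> parcs G" using ab by simp
    \<comment> \<open>\<open>Some\<close> embeds the complement of \<open>G\<close> minus the edge
      into that of \<open>?H\<close> minus the edge, so both properties would pass down and
      contradict \<open>min\<close>.\<close>
    moreover have "(Some x, Some y) \<in> parcs (graph_complement (delete_edge ?H a b))"
      if "(x, y) \<in> parcs (graph_complement (delete_edge G u v))" for x y
      using that by auto
    moreover have "Some ` pverts (graph_complement (delete_edge G u v))
        \<subseteq> pverts (graph_complement (delete_edge ?H a b))"
      by auto
    ultimately show ?thesis
      using min triangle_free_vimage colorable_vimage by metis
  qed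
  ultimately show ?thesis
    using pair_graph_add_vertex[OF G(1), of ?U] triangle_free_complement_add_vertex[OF G(4) K(1)]
    by (auto simp: generation_site_def minimal_prime_graph_def)
qed

end
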